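(* Let $n\geq 1$ and $m>1$ be integers and let $\delta>0$. There exist sets $A\subset B\subset\mathbb{R}^n$ and $1$-Lipschitz maps $v\colon\mathbb{R}^n\to \mathbb{R}^m$ and $u\colon A\to\mathbb{R}^m$ such that $$\sup\big\{\lVert v(x)-u(x)\rVert\mid x\in A\big\}=\delta\quad\text{and}\quad d_{v}(A,B)=\infty,$$ and for any $1$-Lipschitz extension $\tilde{u}\colon B\to\mathbb{R}^m$ of $u$ to $B$ $$\sup\big\{\lVert v(x)-\tilde{u}(x)\rVert\mid x\in B\big\}=\infty.$$
   Context: Euclidean spaces carry the Euclidean norm; a map $f$ on a set $S\subset\mathbb{R}^n$ is $1$-Lipschitz if $\lVert f(x)-f(y)\rVert\leq\lVert x-y\rVert$ for all $x,y\in S$. $d_v(A,B)=\sup\{\lVert v(x)-v(y)\rVert\mid x\in A,\ y\in B\}$. *)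

theory Defs
  imports "HOL-Analysis.Analysis"
begin

text \<open>Suprema of distances may be infinite, so they are taken in \<^typ>\<open>ereal\<close>.\<close>

definition image_dist :: "('a \<Rightarrow> 'b::real_normed_vector) \<Rightarrow> 'a set \<Rightarrow> 'a set \<Rightarrow> ereal" where
  "image_dist v A B = (SUP (x, y) \<in> A \<times> B. ereal (norm (v x - v y)))"

definition sup_dist_on :: "'a set \<Rightarrow> ('a \<Rightarrow> 'b::real_normed_vector) \<Rightarrow> ('a \<Rightarrow> 'b) \<Rightarrow> ereal" where
  "sup_dist_on S v w = (SUP x \<in> S. ereal (norm (v x - w x)))"

end

theory Submission
  imports Defs
begin

text \<open>
  On a ray an isometric embedding \<open>u\<close> of an unbounded set containing the endpoint into a straight line
  has only one 1-Lipschitz extension. A unit-speed curve, on the other hand, loses only about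
  \<open>\<integral> h'(t)\<^sup>2 / 2 dt\<close> in the direction of the line when it makes excursions \<open>h\<close> in an orthogonal direction.
  For the slowly oscillating unbounded \<open>h(t) = c L sin (ln (1 + L))\<close> with \<open>L = ln (1 + t)\<close> we have
  \<open>\<bar>h'(t)\<bar> \<le> 2 c / (1 + t)\<close>, so that the total loss is finite and is at most \<open>2 \<delta>\<close> if \<open>c\<close> is small. Let
  \<open>v\<close> run along such a curve, starting \<open>\<delta>\<close> ahead of \<open>u\<close>, and let \<open>A\<close> be the set of zeros of \<open>h\<close>: on \<open>A\<close>
  the two maps differ by at most \<open>\<delta>\<close>, with equality at the endpoint, whereas on the whole ray the
  difference is at least \<open>\<bar>h\<bar>\<close>.
\<close>

definition wave :: "real \<Rightarrow> real" where
  "wave t = ln (1 + t) * sin (ln (1 + ln (1 + t)))"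

lemma wave_zero [simp]: "wave 0 = 0"
  by (simp add: wave_def)

text \<open>With \<open>L = ln (1 + t)\<close>, the sine's slowly varying argument keeps the
  derivative of \<open>L * sin (ln (1 + L))\<close> in \<open>L\<close> at most 2 in modulus despite
  the unbounded factor \<open>L\<close>; the chain rule contributes
  \<open>1 / (1 + t)\<close>.\<close>

lemma wave_has_derivative_bound:
  assumes "t \<ge> 0"
  obtains d where "(wave has_real_derivative d) (at t)" "\<bar>d\<bar> \<le> 2 / (1 + t)"
proof
  define L where "L = ln (1 + t)"
  define d where "d = (sin (ln (1 + L)) + L / (1 + L) * cos (ln (1 + L))) / (1 + t)"
  have L: "L \<ge> 0"
    using assms by (simp add: L_def)
  have "1 + t > 0" "1 + ln (1 + t) > 0"
    using assms L by (simp_all add: L_def add_pos_nonneg)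
  then show "(wave has_real_derivative d) (at t)"
    unfolding wave_def[abs_def] d_def
    by (auto intro!: derivative_eq_intros simp: L_def divide_simps)
  have "\<bar>sin (ln (1 + L)) + L / (1 + L) * cos (ln (1 + L))\<bar>
      \<le> \<bar>sin (ln (1 + L))\<bar> + \<bar>L / (1 + L)\<bar> * \<bar>cos (ln (1 + L))\<bar>"
    by (metis abs_mult abs_triangle_ineq)
  also have "\<dots> \<le> 1 + 1 * 1"
    using L by (intro add_mono mult_mono) auto
  finally show "\<bar>d\<bar> \<le> 2 / (1 + t)"
    using assms by (simp add: d_def divide_right_mono)
qed

text \<open>The substitution undoes both logarithms, so zeros and peaks can be read off from
  \<open>sin s\<close>.\<close>

lemma wave_exp:
  "wave (exp (exp s - 1) - 1) = (exp s - 1) * sin s"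
  by (simp add: wave_def)

lemma exp_exp_ge: "s \<le> exp (exp s - 1) - (1::real)"
  using exp_ge_add_one_self[of s] exp_ge_add_one_self[of "exp s - 1"] by linarith

lemma wave_zero_unbounded:
  obtains T where "T \<ge> t" "T \<ge> 0" "wave T = 0"
proof -
  obtain k :: nat where k: "\<bar>t\<bar> / pi \<le> k"
    using real_arch_simple by blast
  define T where "T = exp (exp (pi * k) - 1) - 1"
  have "\<bar>t\<bar> \<le> pi * k"
    using k by (simp add: field_simps)
  then have "\<bar>t\<bar> \<le> T"
    using exp_exp_ge[of "pi * k"] by (simp add: T_def)
  moreover have "wave T = 0"
    by (simp add: T_def wave_exp mult.commute[of pi])
  ultimately show thesis
    using that[of T] by linarith
qed

lemma wave_unbounded:
  obtains t where "t \<ge> 0" "wave t \<ge> K"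
proof -
  obtain k :: nat where k: "\<bar>K\<bar> / (2 * pi) \<le> k"
    using real_arch_simple by blast
  define s where "s = pi / 2 + 2 * real k * pi"
  have "\<bar>K\<bar> \<le> 2 * real k * pi"
    using k by (simp add: field_simps)
  then have "\<bar>K\<bar> \<le> s"
    using pi_ge_zero unfolding s_def by linarith
  moreover have "sin s = 1"
    by (simp only: s_def sin_add cos_2npi sin_2npi sin_pi_half)
  moreover have "K \<le> exp s - 1"
    using \<open>\<bar>K\<bar> \<le> s\<close> exp_ge_add_one_self[of s] by linarith
  ultimately have "K \<le> wave (exp (exp s - 1) - 1)"
    by (simp add: wave_exp)
  moreover have "0 \<le> exp (exp s - 1) - 1"
    using \<open>\<bar>K\<bar> \<le> s\<close> exp_exp_ge[of s] by linarith
  ultimately show thesis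
    using that by blast
qed

text \<open>\<open>a * t / (1 + t)\<close> is the integral of \<open>a / (1 + s)\<^sup>2\<close>
  over [0, t], an explicit bounded loss that pays for the transverse motion.\<close>

definition curve :: "real \<Rightarrow> 'm \<Rightarrow> 'm \<Rightarrow> real \<Rightarrow> real ^ 'm::finite" where
  "curve a p q t = (t - a * t / (1 + t)) *\<^sub>R axis p 1 + (sqrt a / 2 * wave t) *\<^sub>R axis q 1"

text \<open>With \<open>r = a / (1 + t)\<^sup>2\<close>, the forward speed is 1 - r and the squared
  transverse speed is at most r. Since 0 \<le> r \<le> 1, the squared speed is at most (1 - r) + r =
  1.\<close>

lemma curve_lipschitz:
  fixes p q :: "'m::finite"
  assumes "p \<noteq> q" "0 \<le> a" "a \<le> 1"
  shows "1-lipschitz_on {0..} (curve a p q)"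
proof (rule lipschitz_onI)
  fix x y :: real
  assume xy: "x \<in> {0..}" "y \<in> {0..}"
  have "\<exists>D. \<forall>t\<in>{0..}. (curve a p q has_vector_derivative D t) (at t within {0..}) \<and> norm (D t) \<le> 1"
  proof (intro bchoice ballI)
    fix t :: real
    assume "t \<in> {0..}"
    then have t: "t \<ge> 0"
      by simp
    obtain d where d: "(wave has_real_derivative d) (at t)" "\<bar>d\<bar> \<le> 2 / (1 + t)"
      using wave_has_derivative_bound[OF t] by blast
    define r where "r = a / (1 + t)\<^sup>2"
    let ?D = "(1 - r) *\<^sub>R axis p 1 + (sqrt a / 2 * d) *\<^sub>R axis q 1 :: real ^ 'm"
    have "((\<lambda>t. t - a * t / (1 + t)) has_real_derivative 1 - r) (at t)"
      using t by (auto intro!: derivative_eq_intros simp: r_def field_simps power2_eq_square)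
    moreover have "((\<lambda>t. sqrt a / 2 * wave t) has_real_derivative sqrt a / 2 * d) (at t)"
      by (rule DERIV_cmult) (rule d)
    ultimately have "(curve a p q has_vector_derivative ?D) (at t)"
      unfolding curve_def[abs_def]
      using has_vector_derivative_add[OF
          has_vector_derivative_scaleR[OF _ has_vector_derivative_const]
          has_vector_derivative_scaleR[OF _ has_vector_derivative_const]]
      by fastforce
    moreover have "norm ?D \<le> 1"
    proof -
      have r: "0 \<le> r" "r \<le> 1"
        using assms t by (auto simp: r_def divide_simps intro: order_trans[OF _ one_le_power])
      have "d\<^sup>2 \<le> (2 / (1 + t))\<^sup>2"
        using d(2) t by (simp add: abs_le_square_iff[symmetric])
      then have "a / 4 * d\<^sup>2 \<le> a / 4 * (2 / (1 + t))\<^sup>2"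
        using assms by (intro mult_left_mono) auto
      then have "(sqrt a / 2 * d)\<^sup>2 \<le> r"
        using assms by (simp add: r_def power_mult_distrib power_divide)
      moreover have "(1 - r)\<^sup>2 \<le> 1 - r"
        using r by (simp add: power2_eq_square mult_left_le_one_le)
      moreover have "(norm ?D)\<^sup>2 = (1 - r)\<^sup>2 + (sqrt a / 2 * d)\<^sup>2"
        using assms(1) unfolding power2_norm_eq_inner
        by (simp add: inner_add_left inner_add_right inner_axis_axis power2_eq_square)
      ultimately have "(norm ?D)\<^sup>2 \<le> 1\<^sup>2"
        by simp
      then show ?thesis
        by (rule power2_le_imp_le) simp
    qed
    ultimately show "\<exists>D. (curve a p q has_vector_derivative D) (at t within {0..}) \<and> norm D \<le> 1"
      using has_vector_derivative_at_within by blast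
  qed
  then obtain D where D: "\<And>t. t \<in> {0..} \<Longrightarrow> (curve a p q has_vector_derivative D t) (at t within {0..})"
      "\<And>t. t \<in> {0..} \<Longrightarrow> norm (D t) \<le> 1"
    by blast
  have "norm (curve a p q x - curve a p q y) \<le> 1 * norm (x - y)"
    using D xy by (intro differentiable_bound[where S = "{0..}" and f' = "\<lambda>t h. h *\<^sub>R D t"])
      (auto simp: has_vector_derivative_def onorm_scaleR_left onorm_id)
  then show "dist (curve a p q x) (curve a p q y) \<le> 1 * dist x y"
    by (simp add: dist_norm)
qed auto

lemma norm_axis_scaleR_diff:
  "norm (s *\<^sub>R axis p 1 - t *\<^sub>R axis p 1 :: real ^ 'm::finite) = \<bar>s - t\<bar>"
  by (metis mult.right_neutral norm_axis_1 norm_scaleR scaleR_left_diff_distrib)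

text \<open>The equality case of the triangle inequality: Cauchy-Schwarz applied to both pieces
  forces \<open>y \<bullet> e = t\<close>, and then |y - t e|^2 = |y|^2 - t^2 \<le> 0.\<close>

lemma between_on_segment_unique:
  fixes e y :: "'a::real_inner"
  assumes e: "norm e = 1" and "norm y \<le> t" "norm (T *\<^sub>R e - y) \<le> T - t"
  shows "y = t *\<^sub>R e"
proof -
  have "y \<bullet> e \<le> t"
    using norm_cauchy_schwarz[of y e] assms by simp
  moreover have "(T *\<^sub>R e - y) \<bullet> e \<le> T - t"
    using norm_cauchy_schwarz[of "T *\<^sub>R e - y" e] assms by simp
  ultimately have ye: "y \<bullet> e = t"
    using e by (simp add: inner_diff_left dot_square_norm)
  have yy: "y \<bullet> y \<le> t\<^sup>2"
    using assms(2) by (metis norm_ge_zero power2_norm_eq_inner power_mono)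
  have ee: "e \<bullet> e = 1"
    using e by (simp add: dot_square_norm)
  have "(y - t *\<^sub>R e) \<bullet> (y - t *\<^sub>R e) \<le> 0"
    using yy ye ee by (simp add: inner_diff_left inner_diff_right inner_commute[of e y] power2_eq_square)
  then show ?thesis
    using inner_ge_zero[of "y - t *\<^sub>R e"] inner_eq_zero_iff[of "y - t *\<^sub>R e"] by simp
qed

theorem proposition2p5:
  fixes \<delta> :: real
  assumes "CARD('m::finite) > 1" and "\<delta> > 0"
  shows "\<exists>(A :: (real ^ 'n::finite) set) (B :: (real ^ 'n) set)
            (v :: real ^ 'n \<Rightarrow> real ^ 'm) (u :: real ^ 'n \<Rightarrow> real ^ 'm).
           A \<subseteq> B \<and> 1-lipschitz_on UNIV v \<and> 1-lipschitz_on A u \<and>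
           sup_dist_on A v u = ereal \<delta> \<and> image_dist v A B = \<infinity> \<and>
           (\<forall>u' :: real ^ 'n \<Rightarrow> real ^ 'm.
              1-lipschitz_on B u' \<and> (\<forall>x\<in>A. u' x = u x) \<longrightarrow> sup_dist_on B v u' = \<infinity>)"
proof -
  obtain p q :: 'm where pq: "p \<noteq> q"
    using assms(1) by (metis One_nat_def card_le_Suc0_iff_eq finite not_le UNIV_I)
  fix i :: 'n
  \<comment> \<open>The bound 1 makes the curve 1-Lipschitz; the bound \<open>2 * \<delta>\<close>
    keeps \<open>\<delta>\<close> minus the loss within [-\<delta>, \<delta>].\<close>
  define a where "a = min 1 (2 * \<delta>)"
  have a: "0 < a" "a \<le> 1" "a \<le> 2 * \<delta>"
    using assms(2) by (auto simp: a_def)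
  define r :: "real \<Rightarrow> real ^ 'n" where "r t = t *\<^sub>R axis i 1" for t
  define B where "B = r ` {0..}"
  define A where "A = r ` {t. t \<ge> 0 \<and> wave t = 0}"
  \<comment> \<open>Clamping the coordinate at 0 is 1-Lipschitz and extends the map from the ray to
    the whole space.\<close>
  define v :: "real ^ 'n \<Rightarrow> real ^ 'm" where "v x = curve a p q (max 0 (x $ i)) + \<delta> *\<^sub>R axis p 1" for x
  define u :: "real ^ 'n \<Rightarrow> real ^ 'm" where "u x = x $ i *\<^sub>R axis p 1" for x
  have r_nth [simp]: "r t $ i = t" for t
    by (simp add: r_def)
  have v_r: "v (r t) = curve a p q t + \<delta> *\<^sub>R axis p 1" if "t \<ge> 0" for t
    using that by (simp add: v_def max_def)
  have v_q: "v (r t) $ q = sqrt a / 2 * wave t" if "t \<ge> 0" for t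
    using that pq by (simp add: v_r curve_def axis_def)
  have dist_r: "dist (r s) (r t) = \<bar>s - t\<bar>" for s t
    by (simp add: dist_norm r_def norm_axis_scaleR_diff)
  have "A \<subseteq> B"
    by (auto simp: A_def B_def)
  have A0: "r 0 \<in> A"
    by (auto simp: A_def)
  have big: "\<exists>t\<ge>0. K \<le> sqrt a / 2 * wave t" for K
  proof -
    obtain t where "t \<ge> 0" "wave t \<ge> 2 * K / sqrt a"
      using wave_unbounded by blast
    then show ?thesis
      using a by (intro exI[of _ t]) (simp add: field_simps)
  qed
  have "1-lipschitz_on UNIV v"
  proof (rule lipschitz_onI)
    fix x y :: "real ^ 'n"
    have "dist (v x) (v y) = dist (curve a p q (max 0 (x $ i))) (curve a p q (max 0 (y $ i)))"
      by (simp add: v_def)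
    also have "\<dots> \<le> 1 * dist (max 0 (x $ i)) (max 0 (y $ i))"
      using curve_lipschitz[OF pq, of a] a by (intro lipschitz_onD) auto
    also have "\<dots> \<le> dist (x $ i) (y $ i)"
      by (auto simp: dist_real_def)
    also have "\<dots> \<le> 1 * dist x y"
      by (simp add: dist_vec_nth_le)
    finally show "dist (v x) (v y) \<le> 1 * dist x y" .
  qed auto
  moreover have "1-lipschitz_on A u"
    by (intro lipschitz_onI) (auto simp: A_def u_def dist_r dist_norm[of "_ *\<^sub>R _"] norm_axis_scaleR_diff)
  moreover have "sup_dist_on A v u = ereal \<delta>"
    unfolding sup_dist_on_def
  proof (rule antisym)
    have "norm (v (r t) - u (r t)) \<le> \<delta>" if t: "t \<ge> 0" "wave t = 0" for t
    proof -
      have "v (r t) - u (r t) = (\<delta> - a * t / (1 + t)) *\<^sub>R axis p 1"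
        using t by (simp add: v_r u_def curve_def algebra_simps)
      moreover have "0 \<le> a * t / (1 + t)"
        using a t by simp
      moreover have "a * t / (1 + t) \<le> a"
        using a t by (simp add: divide_simps algebra_simps)
      ultimately show ?thesis
        using a by simp
    qed
    then show "(SUP x\<in>A. ereal (norm (v x - u x))) \<le> ereal \<delta>"
      by (auto simp: A_def intro!: SUP_least)
    have "norm (v (r 0) - u (r 0)) = \<delta>"
      using assms(2) by (simp add: v_r u_def curve_def)
    then show "ereal \<delta> \<le> (SUP x\<in>A. ereal (norm (v x - u x)))"
      using A0 by (intro SUP_upper2[of "r 0"]) auto
  qed
  moreover have "image_dist v A B = \<infinity>"
    unfolding image_dist_def
  proof (rule SUP_PInfty)
    fix k :: nat
    obtain t where t: "t \<ge> 0" "real k \<le> sqrt a / 2 * wave t"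
      using big by blast
    \<comment> \<open>The wave vanishes at 0, so the \<open>q\<close>-coordinate of the difference
      is the full excursion at \<open>t\<close>.\<close>
    have "real k \<le> \<bar>(v (r 0) - v (r t)) $ q\<bar>"
      using t by (simp add: v_q)
    also have "\<dots> \<le> norm (v (r 0) - v (r t))"
      by (rule component_le_norm_cart)
    finally show "\<exists>z\<in>A \<times> B. ereal (real k) \<le> (case z of (x, y) \<Rightarrow> ereal (norm (v x - v y)))"
      using A0 t by (intro bexI[of _ "(r 0, r t)"]) (auto simp: B_def)
  qed
  moreover have "sup_dist_on B v u' = \<infinity>"
    if u': "1-lipschitz_on B u'" "\<forall>x\<in>A. u' x = u x" for u'
    unfolding sup_dist_on_def
  proof (rule SUP_PInfty)
    fix k :: nat
    obtain t where t: "t \<ge> 0" "real k \<le> sqrt a / 2 * wave t"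
      using big by blast
    \<comment> \<open>A zero beyond \<open>t\<close> places \<open>r t\<close> between
      \<open>r 0\<close> and \<open>r T\<close>, both in \<open>A\<close>, where \<open>u'\<close>
      is prescribed; this pins down \<open>u' (r t)\<close>.\<close>
    obtain T where T: "T \<ge> t" "T \<ge> 0" "wave T = 0"
      using wave_zero_unbounded by blast
    have "dist (u' (r t)) (u' (r 0)) \<le> 1 * dist (r t) (r 0)"
      using t by (intro lipschitz_onD[OF u'(1)]) (auto simp: B_def)
    then have "norm (u' (r t)) \<le> t"
      using u'(2) A0 t by (simp add: dist_r u_def)
    moreover have "dist (u' (r T)) (u' (r t)) \<le> 1 * dist (r T) (r t)"
      using t T by (intro lipschitz_onD[OF u'(1)]) (auto simp: B_def)
    moreover have "u' (r T) = T *\<^sub>R axis p 1"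
      using u'(2) T by (auto simp: A_def u_def)
    ultimately have "u' (r t) = t *\<^sub>R axis p 1"
      using T by (intro between_on_segment_unique[where T = T]) (auto simp: dist_r dist_norm[of "_ *\<^sub>R _"])
    \<comment> \<open>\<open>u' (r t)\<close> has \<open>q\<close>-coordinate 0, so the difference
      retains the whole excursion of \<open>v\<close>.\<close>
    then have "real k \<le> \<bar>(v (r t) - u' (r t)) $ q\<bar>"
      using t pq by (simp add: v_q axis_def)
    also have "\<dots> \<le> norm (v (r t) - u' (r t))"
      by (rule component_le_norm_cart)
    finally show "\<exists>x\<in>B. ereal (real k) \<le> ereal (norm (v x - u' x))"
      using t by (auto simp: B_def)
  qed
  ultimately show ?thesis
    using \<open>A \<subseteq> B\<close> by blast
qed

end
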